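(* Let $p\geq 3$ be an odd prime, let $n\geq 2$ be an integer, and let $\zeta_p:\{\xi\in\mathbb{Z}:\gcd(\xi,p)=1\}\to\{0,1\}$ be a function such that (1) if $\gcd(\theta_1,p)=\gcd(\theta_2,p)=1$ and $\theta_1\equiv\theta_2\pmod p$, then $\zeta_p(\theta_1)=\zeta_p(\theta_2)$; and (2) the sets $A_i=\{a:\zeta_p(a)=i,\ 1\leq a\leq p-1\}$, $i=0,1$, satisfy $|A_0|=|A_1|=\frac{p-1}{2}$. Suppose that $\zeta_p(1)=1$ and $\zeta_p(2)=0$. Let $G$ be a simple connected graph of order $n$ and size $n+\varepsilon$, where $\varepsilon\in\{-1,0,1\}$, and let $S=\{1,2,\ldots,np\}$. Then the corona graph $G\circ P_{p-1}$ is an arithmetic cordial graph modulo $p$ under $\langle S,\zeta_p,+\rangle$, where $+$ is ordinary addition of integers.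
   Context: The order of a graph is its number of vertices and its size is its number of edges. $P_k$ denotes the path graph on $k$ vertices. Corona graph: $G\circ H$ is obtained from one copy of $G$ and $|V(G)|$ disjoint copies of $H$ by joining every vertex of the $i$th copy of $H$ to the $i$th vertex of $G$. Arithmetic cordial graph: let $\eta$ be a positive integer, $S\subseteq\mathbb{Z}$, $\star:S\times S\to\mathbb{Z}$ a binary function, and $\zeta_\eta:\{\xi\in\mathbb{Z}:\gcd(\xi,\eta)=1\}\to\{0,1\}$ a function. The triple $\langle S,\zeta_\eta,\star\rangle$ is called an arithmetic structure. For a simple connected graph $\Gamma$ of order $N$, a bijection $f:V(\Gamma)\to S$ (where $|S|=N$) is an arithmetic cordial labeling modulo $\eta$ under $\langle S,\zeta_\eta,\star\rangle$ if the induced function $f_\eta^*:E(\Gamma)\to\{0,1\}$, defined by $f_\eta^*(ab)=0$ if $\gcd(f(a)\star f(b),\eta)\neq 1$ or $\zeta_\eta(f(a)\star f(b))=0$, and $f_\eta^*(ab)=1$ if $\gcd(f(a)\star f(b),\eta)=1$ and $\zeta_\eta(f(a)\star f(b))=1$, satisfies $|e_{f_\eta^*}(0)-e_{f_\eta^*}(1)|\leq 1$, where $e_{f_\eta^*}(i)$ is the number of edges with label $i$. A graph admitting such a labeling is an arithmetic cordial graph modulo $\eta$ under $\langle S,\zeta_\eta,\star\rangle$. *)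

theory Defs
  imports Complex_Main "HOL-Number_Theory.Cong"
begin

record 'a ugraph =
  verts :: "'a set"
  edges :: "'a set set"

definition simple_graph :: "'a ugraph \<Rightarrow> bool" where
  "simple_graph G \<longleftrightarrow>
     finite (verts G) \<and> (\<forall>e \<in> edges G. e \<subseteq> verts G \<and> card e = 2)"

definition connected_graph :: "'a ugraph \<Rightarrow> bool" where
  "connected_graph G \<longleftrightarrow> verts G \<noteq> {} \<and>
     (\<forall>u \<in> verts G. \<forall>v \<in> verts G. (u, v) \<in> {(x, y). {x, y} \<in> edges G}\<^sup>*)"

definition graph_order :: "'a ugraph \<Rightarrow> nat" where
  "graph_order G = card (verts G)"

definition graph_size :: "'a ugraph \<Rightarrow> nat" where
  "graph_size G = card (edges G)"

definition path_graph :: "nat \<Rightarrow> nat ugraph" where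
  "path_graph k = \<lparr> verts = {1..k}, edges = {{i, i + 1} | i. 1 \<le> i \<and> i < k} \<rparr>"

text \<open>
  The copies of \<open>H\<close> are indexed by the vertices of \<open>G\<close>: \<open>Inl v\<close> is the vertex \<open>v\<close> of \<open>G\<close>,
  and \<open>Inr (v, w)\<close> is the vertex \<open>w\<close> in the copy of \<open>H\<close> attached to \<open>v\<close>.
\<close>

definition corona :: "'a ugraph \<Rightarrow> 'b ugraph \<Rightarrow> ('a + 'a \<times> 'b) ugraph" where
  "corona G H =
     \<lparr> verts = Inl ` verts G \<union> Inr ` (verts G \<times> verts H),
       edges = {Inl ` e | e. e \<in> edges G}
             \<union> {(\<lambda>w. Inr (v, w)) ` e | v e. v \<in> verts G \<and> e \<in> edges H}
             \<union> {{Inl v, Inr (v, w)} | v w. v \<in> verts G \<and> w \<in> verts H} \<rparr>"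

text \<open>
  \<open>\<zeta>\<close> and \<open>star\<close> are total functions in HOL. Only the values of \<open>\<zeta>\<close> at integers
  coprime to \<open>\<eta>\<close> and the values of \<open>star\<close> on \<open>S \<times> S\<close> matter.
\<close>

definition arithmetic_structure ::
    "nat \<Rightarrow> int set \<Rightarrow> (int \<Rightarrow> nat) \<Rightarrow> (int \<Rightarrow> int \<Rightarrow> int) \<Rightarrow> bool" where
  "arithmetic_structure \<eta> S \<zeta> star \<longleftrightarrow>
     \<eta> > 0 \<and> (\<forall>\<xi>. gcd \<xi> (int \<eta>) = 1 \<longrightarrow> \<zeta> \<xi> \<in> {0, 1})"

definition arithmetic_label ::
    "nat \<Rightarrow> (int \<Rightarrow> nat) \<Rightarrow> (int \<Rightarrow> int \<Rightarrow> int) \<Rightarrow> int \<Rightarrow> int \<Rightarrow> nat" where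
  "arithmetic_label \<eta> \<zeta> star x y =
     (if gcd (star x y) (int \<eta>) \<noteq> 1 \<or> \<zeta> (star x y) = 0 then 0 else 1)"

text \<open>
  The induced edge labeling is a function \<open>g\<close> of the unordered edge, so it exists only if the two
  ways of writing each edge give the same label. This is automatic for commutative \<open>star\<close>;
  when it exists, \<open>g\<close> is uniquely determined on the edges.
\<close>

definition induced_edge_labeling ::
    "nat \<Rightarrow> (int \<Rightarrow> nat) \<Rightarrow> (int \<Rightarrow> int \<Rightarrow> int) \<Rightarrow> 'a ugraph \<Rightarrow> ('a \<Rightarrow> int) \<Rightarrow>
     ('a set \<Rightarrow> nat) \<Rightarrow> bool" where
  "induced_edge_labeling \<eta> \<zeta> star G f g \<longleftrightarrow>
     (\<forall>a b. {a, b} \<in> edges G \<longrightarrow> g {a, b} = arithmetic_label \<eta> \<zeta> star (f a) (f b))"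

definition edge_count :: "'a ugraph \<Rightarrow> ('a set \<Rightarrow> nat) \<Rightarrow> nat \<Rightarrow> nat" where
  "edge_count G g i = card {e \<in> edges G. g e = i}"

definition arithmetic_cordial_labeling ::
    "nat \<Rightarrow> int set \<Rightarrow> (int \<Rightarrow> nat) \<Rightarrow> (int \<Rightarrow> int \<Rightarrow> int) \<Rightarrow> 'a ugraph \<Rightarrow>
     ('a \<Rightarrow> int) \<Rightarrow> bool" where
  "arithmetic_cordial_labeling \<eta> S \<zeta> star G f \<longleftrightarrow>
     bij_betw f (verts G) S \<and>
     (\<exists>g. induced_edge_labeling \<eta> \<zeta> star G f g \<and>
          \<bar>int (edge_count G g 0) - int (edge_count G g 1)\<bar> \<le> 1)"

definition arithmetic_cordial_graph ::
    "nat \<Rightarrow> int set \<Rightarrow> (int \<Rightarrow> nat) \<Rightarrow> (int \<Rightarrow> int \<Rightarrow> int) \<Rightarrow> 'a ugraph \<Rightarrow> bool" where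
  "arithmetic_cordial_graph \<eta> S \<zeta> star G \<longleftrightarrow>
     arithmetic_structure \<eta> S \<zeta> star \<and> simple_graph G \<and> connected_graph G \<and>
     (\<exists>f. arithmetic_cordial_labeling \<eta> S \<zeta> star G f)"

end

theory Submission
  imports Defs
begin

text \<open>
  Write \<open>p = 2 k + 1\<close>. The interval \<open>{1..n p}\<close> is cut into \<open>n\<close> blocks of \<open>p\<close> consecutive integers,
  one for each vertex \<open>v\<close> of \<open>G\<close>. Inside its block, \<open>v\<close> gets the midpoint \<open>c\<close>, and the attached path
  gets the other numbers in the zigzag order \<open>c + 1, c - 1, c + 2, c - 2, \<dots>, c + k, c - k\<close>
  (lemma \<open>bij_betw_zigzag\<close>). The point is that \<open>2 c\<close> is congruent to \<open>1\<close> modulo \<open>p\<close>, so all label sums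
  are known modulo \<open>p\<close>. Count an edge with label \<open>0\<close> as \<open>+1\<close> and an edge with label \<open>1\<close> as \<open>-1\<close>.

  \<^item> An edge of \<open>G\<close> has sum \<open>1\<close>, hence sign \<open>-1\<close>. Together these edges contribute \<open>-(n + \<epsilon>)\<close>.

  \<^item> Along a path the sums are alternately \<open>1, 2, 1, \<dots>, 1\<close>, so the signs are \<open>-1, 1, -1, \<dots>, -1\<close>
    and each path contributes \<open>-1\<close> (lemma \<open>sum_alternating_signs\<close>).

  \<^item> The spokes at \<open>v\<close> have sums running once through every residue except \<open>2 c = 1\<close>. Over all
    residues the signs add up to \<open>1\<close>, because \<open>\<zeta>\<close> is balanced on the nonzero residues and the
    residue \<open>0\<close> has sign \<open>+1\<close>; leaving out the residue \<open>1\<close> of sign \<open>-1\<close> gives \<open>2\<close>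
    (lemma \<open>sum_spoke_signs\<close>).

  The total is \<open>-(n + \<epsilon>) - n + 2 n = -\<epsilon>\<close>.
\<close>

section \<open>Edges and vertices of a corona\<close>

lemma simple_graph_finite_edges:
  assumes "simple_graph G"
  shows "finite (edges G)"
proof -
  have "edges G \<subseteq> Pow (verts G)" "finite (verts G)"
    using assms by (auto simp: simple_graph_def)
  then show ?thesis by (meson finite_Pow_iff finite_subset)
qed

lemma simple_graph_edgeE:
  assumes "simple_graph G" "e \<in> edges G"
  obtains a b where "e = {a, b}" "a \<noteq> b" "a \<in> verts G" "b \<in> verts G"
proof -
  have "card e = 2" "e \<subseteq> verts G" using assms by (auto simp: simple_graph_def)
  then show ?thesis using that by (auto simp: card_2_iff)
qed

lemma simple_graph_corona:
  assumes "simple_graph G" "simple_graph H"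
  shows "simple_graph (corona G H)"
proof -
  have "card (Inl ` e :: ('a + 'a \<times> 'b) set) = card e" for e :: "'a set"
    by (simp add: card_image)
  moreover have "card ((\<lambda>w. Inr (v, w)) ` e :: ('a + 'a \<times> 'b) set) = card e" for v :: 'a and e :: "'b set"
    by (rule card_image) (simp add: inj_on_def)
  ultimately have "card d = 2" if "d \<in> edges (corona G H)" for d
    using that assms by (auto simp: simple_graph_def corona_def)
  moreover have "d \<subseteq> verts (corona G H)" if "d \<in> edges (corona G H)" for d
    using that assms by (auto simp: simple_graph_def corona_def) blast+
  moreover have "finite (verts (corona G H))"
    using assms by (simp add: simple_graph_def corona_def)
  ultimately show ?thesis by (simp add: simple_graph_def)
qed

text \<open>
  Each vertex of a copy of \<open>H\<close> is one spoke away from its hub in \<open>G\<close>, and hubs are connected to each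
  other by walks inside \<open>G\<close>.
\<close>

lemma connected_graph_corona:
  assumes "connected_graph G"
  shows "connected_graph (corona G H)"
proof -
  define R where "R = {(x, y). {x, y} \<in> edges (corona G H)}"
  have GG: "(Inl u, Inl v) \<in> R\<^sup>*" if "u \<in> verts G" "v \<in> verts G" for u v
  proof -
    have "(u, v) \<in> {(x, y). {x, y} \<in> edges G}\<^sup>*"
      using assms that by (auto simp: connected_graph_def)
    then show ?thesis
    proof (induction rule: rtrancl_induct)
      case base then show ?case by simp
    next
      case (step y z)
      have "Inl ` {y, z} \<in> edges (corona G H)"
        using step.hyps(2) by (auto simp: corona_def)
      then have "(Inl y, Inl z) \<in> R" by (simp add: R_def)
      then show ?case using step.IH by simp
    qed
  qed
  have spoke: "(Inl v, Inr (v, w)) \<in> R" "(Inr (v, w), Inl v) \<in> R"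
    if "v \<in> verts G" "w \<in> verts H" for v w
    using that by (auto simp: R_def corona_def insert_commute)
  have hub: "\<exists>v \<in> verts G. (x, Inl v) \<in> R\<^sup>* \<and> (Inl v, x) \<in> R\<^sup>*" if "x \<in> verts (corona G H)" for x
    using that spoke by (fastforce simp: corona_def)
  have "(x, y) \<in> R\<^sup>*" if "x \<in> verts (corona G H)" "y \<in> verts (corona G H)" for x y
    using hub[OF that(1)] hub[OF that(2)] GG by (meson rtrancl_trans)
  moreover have "verts (corona G H) \<noteq> {}"
    using assms by (auto simp: connected_graph_def corona_def)
  ultimately show ?thesis by (simp add: connected_graph_def R_def)
qed

lemma card_verts_corona:
  assumes "finite (verts G)" "finite (verts H)"
  shows "card (verts (corona G H)) = card (verts G) * Suc (card (verts H))"
proof -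
  have "card (verts (corona G H)) =
      card (Inl ` verts G :: ('a + 'a \<times> 'b) set) + card (Inr ` (verts G \<times> verts H) :: ('a + 'a \<times> 'b) set)"
    unfolding corona_def using assms by (simp, intro card_Un_disjoint) auto
  then show ?thesis by (simp add: card_image card_cartesian_product)
qed

lemma sum_edges_corona:
  fixes \<phi> :: "('a + 'a \<times> 'b) set \<Rightarrow> int"
  assumes "simple_graph G" "simple_graph H"
  shows "sum \<phi> (edges (corona G H)) =
      (\<Sum>e\<in>edges G. \<phi> (Inl ` e))
    + (\<Sum>v\<in>verts G. \<Sum>e\<in>edges H. \<phi> ((\<lambda>w. Inr (v, w)) ` e))
    + (\<Sum>v\<in>verts G. \<Sum>w\<in>verts H. \<phi> {Inl v, Inr (v, w)})"
proof -
  define copy :: "'a \<times> 'b set \<Rightarrow> ('a + 'a \<times> 'b) set" where "copy = (\<lambda>(v, e). (\<lambda>w. Inr (v, w)) ` e)"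
  define spoke :: "'a \<times> 'b \<Rightarrow> ('a + 'a \<times> 'b) set" where "spoke = (\<lambda>(v, w). {Inl v, Inr (v, w)})"
  define E1 :: "('a + 'a \<times> 'b) set set" where "E1 = (`) Inl ` edges G"
  define E2 where "E2 = copy ` (verts G \<times> edges H)"
  define E3 where "E3 = spoke ` (verts G \<times> verts H)"
  have fin: "finite (verts G)" "finite (verts H)" "finite (edges G)" "finite (edges H)"
    using assms simple_graph_finite_edges by (auto simp: simple_graph_def)
  have ne: "{} \<notin> edges G" "{} \<notin> edges H"
    using assms by (auto simp: simple_graph_def)
  have E: "edges (corona G H) = E1 \<union> E2 \<union> E3"
    by (auto simp: corona_def E1_def E2_def E3_def copy_def spoke_def)
  have split: "sum \<phi> (E1 \<union> E2 \<union> E3) = sum \<phi> E1 + sum \<phi> E2 + sum \<phi> E3"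
  proof -
    have "Inl ` e \<noteq> copy (v, e')" if "e \<in> edges G" for v e e'
    proof -
      obtain a where "a \<in> e" using ne(1) \<open>e \<in> edges G\<close> by fastforce
      then have "Inl a \<in> Inl ` e" by simp
      moreover have "Inl a \<notin> copy (v, e')" by (auto simp: copy_def)
      ultimately show ?thesis by metis
    qed
    then have "E1 \<inter> E2 = {}" by (auto simp: E1_def E2_def)
    moreover have "(E1 \<union> E2) \<inter> E3 = {}" by (auto simp: E1_def E2_def E3_def copy_def spoke_def)
    ultimately show ?thesis
      using fin by (subst sum.union_disjoint, simp_all add: E1_def E2_def E3_def)+
  qed
  have S1: "sum \<phi> E1 = (\<Sum>e\<in>edges G. \<phi> (Inl ` e))"
  proof -
    have "inj_on ((`) (Inl :: 'a \<Rightarrow> 'a + 'a \<times> 'b)) (edges G)"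
      by (auto simp: inj_on_def inj_image_eq_iff)
    then show ?thesis by (simp add: E1_def sum.reindex)
  qed
  have S2: "sum \<phi> E2 = (\<Sum>v\<in>verts G. \<Sum>e\<in>edges H. \<phi> ((\<lambda>w. Inr (v, w)) ` e))"
  proof -
    have "inj_on copy (verts G \<times> edges H)"
    proof (rule inj_onI)
      fix x y assume x: "x \<in> verts G \<times> edges H" and y: "y \<in> verts G \<times> edges H"
        and eq: "copy x = copy y"
      obtain v e v' e' where xy: "x = (v, e)" "y = (v', e')" by (metis surj_pair)
      have fibre: "copy (u, d) = Inr ` ({u} \<times> d)" for u d
        by (auto simp: copy_def)
      have "{v} \<times> e = {v'} \<times> e'"
        using eq by (simp add: xy fibre inj_image_eq_iff)
      moreover have "e \<noteq> {}" "e' \<noteq> {}" using x y ne by (auto simp: xy)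
      ultimately show "x = y" by (auto simp: xy times_eq_iff)
    qed
    then show ?thesis
      by (simp add: E2_def sum.reindex sum.cartesian_product copy_def case_prod_unfold)
  qed
  have S3: "sum \<phi> E3 = (\<Sum>v\<in>verts G. \<Sum>w\<in>verts H. \<phi> {Inl v, Inr (v, w)})"
  proof -
    have "inj_on spoke (verts G \<times> verts H)"
      by (auto simp: inj_on_def spoke_def doubleton_eq_iff)
    then show ?thesis
      by (simp add: E3_def sum.reindex sum.cartesian_product spoke_def case_prod_unfold)
  qed
  show ?thesis by (simp add: E split S1 S2 S3)
qed

lemma edges_path_graph: "edges (path_graph m) = (\<lambda>i. {i, i + 1}) ` {1..<m}"
  by (auto simp: path_graph_def)

lemma simple_graph_path_graph: "simple_graph (path_graph m)"
  by (auto simp: simple_graph_def path_graph_def)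

lemma sum_edges_path_graph:
  fixes \<phi> :: "nat set \<Rightarrow> int"
  shows "sum \<phi> (edges (path_graph m)) = (\<Sum>i\<in>{1..<m}. \<phi> {i, i + 1})"
proof -
  have "inj_on (\<lambda>i::nat. {i, i + 1}) {1..<m}"
    by (auto simp: inj_on_def doubleton_eq_iff)
  then show ?thesis by (simp add: edges_path_graph sum.reindex)
qed

section \<open>Signs of residues\<close>

definition label_sign :: "nat \<Rightarrow> (int \<Rightarrow> nat) \<Rightarrow> int \<Rightarrow> int" where
  "label_sign p \<zeta> x = 1 - 2 * int (arithmetic_label p \<zeta> (+) x 0)"

lemma label_sign_eq:
  "label_sign p \<zeta> x = (if gcd x (int p) \<noteq> 1 \<or> \<zeta> x = 0 then 1 else - 1)"
  by (simp add: label_sign_def arithmetic_label_def)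

lemma label_sign_cong:
  assumes "\<And>\<theta>1 \<theta>2. gcd \<theta>1 (int p) = 1 \<Longrightarrow> gcd \<theta>2 (int p) = 1 \<Longrightarrow>
             [\<theta>1 = \<theta>2] (mod int p) \<Longrightarrow> \<zeta> \<theta>1 = \<zeta> \<theta>2"
    and "[x = y] (mod int p)"
  shows "label_sign p \<zeta> x = label_sign p \<zeta> y"
proof -
  have "gcd x (int p) = gcd y (int p)" using assms(2) by (rule cong_gcd_eq)
  moreover have "\<zeta> x = \<zeta> y" if "gcd x (int p) = 1" "gcd y (int p) = 1"
    using assms(1)[OF that assms(2)] .
  ultimately show ?thesis by (simp add: label_sign_eq)
qed

lemma edge_count_difference:
  assumes "finite (edges G)" "\<And>e. e \<in> edges G \<Longrightarrow> g e \<in> {0, 1}"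
  shows "int (edge_count G g 0) - int (edge_count G g 1) = (\<Sum>e\<in>edges G. 1 - 2 * int (g e))"
proof -
  have count: "int (edge_count G g i) = (\<Sum>e\<in>edges G. if g e = i then 1 else 0)" for i
    using assms(1) by (simp add: edge_count_def sum.If_cases Int_def)
  have "(\<Sum>e\<in>edges G. 1 - 2 * int (g e)) =
      (\<Sum>e\<in>edges G. (if g e = 0 then 1 else 0) - (if g e = 1 then 1 else 0))"
    using assms(2) by (intro sum.cong refl) fastforce
  then show ?thesis by (simp add: count sum_subtractf)
qed

lemma sum_periodic:
  fixes h :: "int \<Rightarrow> int"
  assumes "m > 0" "\<And>x y. [x = y] (mod m) \<Longrightarrow> h x = h y"
  shows "(\<Sum>x\<in>{a..<a + m}. h x) = (\<Sum>x\<in>{0..<m}. h x)"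
proof (rule sum.reindex_bij_witness[where i = "\<lambda>y. a + (y - a) mod m" and j = "\<lambda>x. x mod m"])
  fix x assume "x \<in> {a..<a + m}"
  then have "(x - a) mod m = x - a" by simp
  then show "a + (x mod m - a) mod m = x" by (simp add: mod_simps)
  show "x mod m \<in> {0..<m}" using assms(1) by simp
  show "h (x mod m) = h x" by (rule assms(2)) (simp add: cong_def)
next
  fix y assume "y \<in> {0..<m}"
  then show "(a + (y - a) mod m) mod m = y" by (simp add: mod_simps)
  show "a + (y - a) mod m \<in> {a..<a + m}" using assms(1) by simp
qed

text \<open>
  The balance of \<open>\<zeta>\<close> cancels the nonzero residues. What remains is the residue \<open>0\<close>, which is not
  coprime to \<open>p\<close> and therefore always has sign \<open>+1\<close>.
\<close>

lemma sum_label_sign: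
  fixes \<zeta> :: "int \<Rightarrow> nat"
  assumes "prime p"
    and "\<And>\<xi>. gcd \<xi> (int p) = 1 \<Longrightarrow> \<zeta> \<xi> \<in> {0, 1}"
    and "card {a. \<zeta> a = 0 \<and> 1 \<le> a \<and> a \<le> int p - 1} = card {a. \<zeta> a = 1 \<and> 1 \<le> a \<and> a \<le> int p - 1}"
  shows "(\<Sum>x\<in>{0..<int p}. label_sign p \<zeta> x) = 1"
proof -
  let ?A = "\<lambda>i. {a. \<zeta> a = i \<and> 1 \<le> a \<and> a \<le> int p - 1}"
  have p: "p > 1" using assms(1) by (rule prime_gt_1_nat)
  have cop: "gcd x (int p) = 1" if "x \<in> {1..int p - 1}" for x
  proof -
    have "\<not> int p dvd x" using that zdvd_not_zless[of x "int p"] by auto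
    then have "coprime (int p) x" using assms(1) by (simp add: prime_imp_coprime)
    then show ?thesis by (simp add: coprime_iff_gcd_eq_1 gcd.commute)
  qed
  have fin: "finite (?A i)" for i
    by (rule finite_subset[of _ "{1..int p - 1}"]) auto
  have "\<zeta> x = 0 \<or> \<zeta> x = 1" if "x \<in> {1..int p - 1}" for x
    using assms(2)[OF cop[OF that]] by simp
  then have "{1..int p - 1} \<subseteq> ?A 0 \<union> ?A 1" by force
  then have "{1..int p - 1} = ?A 0 \<union> ?A 1" by auto
  then have "(\<Sum>x\<in>{1..int p - 1}. label_sign p \<zeta> x) =
      (\<Sum>x\<in>?A 0. label_sign p \<zeta> x) + (\<Sum>x\<in>?A 1. label_sign p \<zeta> x)"
    using fin by (simp add: sum.union_disjoint disjoint_iff)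
  also have "(\<Sum>x\<in>?A 0. label_sign p \<zeta> x) = (\<Sum>x\<in>?A 0. 1)"
    by (rule sum.cong) (auto simp: label_sign_eq)
  also have "(\<Sum>x\<in>?A 1. label_sign p \<zeta> x) = (\<Sum>x\<in>?A 1. - 1)"
    by (rule sum.cong) (auto simp: label_sign_eq cop)
  finally have "(\<Sum>x\<in>{1..int p - 1}. label_sign p \<zeta> x) = 0"
    using assms(3) by simp
  moreover have "{0..<int p} = insert 0 {1..int p - 1}" using p by auto
  moreover have "label_sign p \<zeta> 0 = 1" using p by (simp add: label_sign_eq)
  ultimately show ?thesis by simp
qed

section \<open>The zigzag labeling\<close>

text \<open>
  This enumerates the integers as \<open>0, 1, -1, 2, -2, \<dots>\<close>. Index \<open>0\<close> is meant for a vertex of \<open>G\<close> and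
  index \<open>w \<ge> 1\<close> for the vertex \<open>w\<close> of the attached path.
\<close>

definition zigzag :: "nat \<Rightarrow> int" where
  "zigzag w = (if odd w then int ((w + 1) div 2) else - int (w div 2))"

lemma zigzag_0 [simp]: "zigzag 0 = 0"
  by (simp add: zigzag_def)

lemma zigzag_consecutive: "zigzag w + zigzag (w + 1) = (if odd w then 0 else 1)"
  by (auto simp: zigzag_def elim!: oddE evenE)

lemma bij_betw_zigzag: "bij_betw zigzag {0..2 * k} {- int k..int k}"
proof (rule bij_betw_byWitness)
  let ?inv = "\<lambda>y. if y > 0 then nat (2 * y - 1) else nat (- 2 * y)"
  show "\<forall>w\<in>{0..2 * k}. ?inv (zigzag w) = w"
  proof
    fix w :: nat
    show "?inv (zigzag w) = w"
    proof (cases "odd w")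
      case True
      then obtain j where "w = 2 * j + 1" by (elim oddE)
      then show ?thesis by (simp add: zigzag_def)
    next
      case False
      then obtain j where "w = 2 * j" by (auto elim: evenE)
      then show ?thesis by (simp add: zigzag_def)
    qed
  qed
  show "\<forall>y\<in>{- int k..int k}. zigzag (?inv y) = y"
  proof
    fix y :: int
    show "zigzag (?inv y) = y"
    proof (cases "y > 0")
      case True
      then obtain j where "y = int (Suc j)" by (metis zero_less_imp_eq_int gr0_implies_Suc)
      then have "?inv y = 2 * j + 1" using True by simp
      then show ?thesis by (simp add: zigzag_def \<open>y = int (Suc j)\<close>)
    next
      case False
      then obtain j where "y = - int j" by (metis int_cases2 neg_0_less_iff_less of_nat_0_less_iff of_nat_0 minus_zero gr0I)
      then have "?inv y = 2 * j" by simp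
      then show ?thesis by (simp add: zigzag_def \<open>y = - int j\<close>)
    qed
  qed
  show "zigzag ` {0..2 * k} \<subseteq> {- int k..int k}"
    by (auto simp: zigzag_def elim!: oddE)
  show "?inv ` {- int k..int k} \<subseteq> {0..2 * k}"
    by auto
qed

definition corona_index :: "'a + 'a \<times> nat \<Rightarrow> 'a \<times> nat" where
  "corona_index x = (case x of Inl v \<Rightarrow> (v, 0) | Inr y \<Rightarrow> y)"

text \<open>
  The summand \<open>k + 1\<close> is the midpoint of \<open>{1..2 k + 1}\<close>, and \<open>b\<close> numbers the blocks from \<open>0\<close>.
\<close>

definition zigzag_labeling :: "nat \<Rightarrow> ('a \<Rightarrow> nat) \<Rightarrow> 'a + 'a \<times> nat \<Rightarrow> int" where
  "zigzag_labeling k b x =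
     (case corona_index x of (v, w) \<Rightarrow> int (2 * k + 1) * int (b v) + int (k + 1) + zigzag w)"

lemma zigzag_labeling_simps:
  "zigzag_labeling k b (Inl v) = int (2 * k + 1) * int (b v) + int (k + 1)"
  "zigzag_labeling k b (Inr (v, w)) = int (2 * k + 1) * int (b v) + int (k + 1) + zigzag w"
  by (simp_all add: zigzag_labeling_def corona_index_def)

text \<open>
  Block number and position inside the block are quotient and remainder of \<open>f x - 1\<close> modulo \<open>2 k + 1\<close>,
  which gives injectivity; surjectivity then follows by counting vertices.
\<close>

lemma bij_betw_zigzag_labeling:
  assumes "finite (verts G)" "bij_betw b (verts G) {0..<n}"
  shows "bij_betw (zigzag_labeling k b) (verts (corona G (path_graph (2 * k)))) {1..int (n * (2 * k + 1))}"
    (is "bij_betw ?f ?V ?S")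
proof -
  define p where "p = int (2 * k + 1)"
  have index: "corona_index x \<in> verts G \<times> {0..2 * k}" if "x \<in> ?V" for x
    using that by (auto simp: corona_def corona_index_def path_graph_def)
  have zz: "zigzag w \<in> {- int k..int k}" if "w \<in> {0..2 * k}" for w
    using bij_betw_apply[OF bij_betw_zigzag that] .
  have bn: "b v < n" if "v \<in> verts G" for v
    using bij_betw_apply[OF assms(2) that] by simp
  have f: "?f x = p * int (b (fst (corona_index x))) + (int k + zigzag (snd (corona_index x))) + 1" for x
    by (simp add: zigzag_labeling_def p_def case_prod_unfold)
  have inj: "inj_on ?f ?V"
  proof (rule inj_onI)
    fix x y assume x: "x \<in> ?V" and y: "y \<in> ?V" and eq: "?f x = ?f y"
    obtain v w v' w' where ix: "corona_index x = (v, w)" "corona_index y = (v', w')"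
      by (metis surj_pair)
    have mem: "v \<in> verts G" "v' \<in> verts G" "w \<in> {0..2 * k}" "w' \<in> {0..2 * k}"
      using index[OF x] index[OF y] by (auto simp: ix)
    have range: "0 \<le> int k + zigzag w" "int k + zigzag w < p" "0 \<le> int k + zigzag w'" "int k + zigzag w' < p"
      using zz[OF mem(3)] zz[OF mem(4)] by (auto simp: p_def)
    have same: "p * int (b v) + (int k + zigzag w) = p * int (b v') + (int k + zigzag w')"
      using eq by (simp add: f ix)
    then have "(p * int (b v) + (int k + zigzag w)) div p = (p * int (b v') + (int k + zigzag w')) div p"
      "(p * int (b v) + (int k + zigzag w)) mod p = (p * int (b v') + (int k + zigzag w')) mod p"
      by (simp_all only: same)
    then have "b v = b v'" "zigzag w = zigzag w'" using range by simp_all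
    then have "v = v'" "w = w'"
      using mem assms(2) bij_betw_zigzag[of k] by (auto simp: bij_betw_def inj_on_def)
    then have "corona_index x = corona_index y" by (simp add: ix)
    then show "x = y" using x y
      by (auto simp: corona_def corona_index_def path_graph_def)
  qed
  have "?f ` ?V \<subseteq> ?S"
  proof (rule image_subsetI)
    fix x assume x: "x \<in> ?V"
    obtain v w where ix: "corona_index x = (v, w)" by (metis surj_pair)
    have mem: "v \<in> verts G" "w \<in> {0..2 * k}" using index[OF x] by (auto simp: ix)
    have "p * int (b v) + p \<le> p * int n"
    proof -
      have "p * (int (b v) + 1) \<le> p * int n"
        using bn[OF mem(1)] by (intro mult_left_mono) (auto simp: p_def)
      then show ?thesis by (simp add: algebra_simps)
    qed
    moreover have "0 \<le> p * int (b v)" by (simp add: p_def)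
    moreover have "int (n * (2 * k + 1)) = p * int n" by (simp add: p_def algebra_simps)
    moreover have "int k + zigzag w \<ge> 0" "int k + zigzag w < p" using zz[OF mem(2)] by (auto simp: p_def)
    ultimately show "?f x \<in> ?S" by (simp add: f ix)
  qed
  moreover have "card (?f ` ?V) = card ?S"
  proof -
    have "card (verts G) = n" using bij_betw_same_card[OF assms(2)] by simp
    moreover have "card ?V = card (verts G) * Suc (2 * k)"
      using card_verts_corona[OF assms(1), of "path_graph (2 * k)"] by (simp add: path_graph_def)
    moreover have "card ?S = n * (2 * k + 1)"
      by (simp only: card_atLeastAtMost_int)
    ultimately show ?thesis
      using inj by (simp add: card_image)
  qed
  ultimately have "?f ` ?V = ?S" by (intro card_subset_eq) auto
  then show ?thesis using inj by (simp add: bij_betw_def)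
qed

text \<open>A path on \<open>2 k\<close> vertices has an odd number of edges, so one sign is left over.\<close>

lemma sum_alternating_signs:
  fixes k :: nat
  assumes "k \<ge> 1"
  shows "(\<Sum>i\<in>{1..<2 * k}. if odd i then - 1 else 1 :: int) = - 1"
  using assms
proof (induction k rule: dec_induct)
  case base then show ?case by (simp add: numeral_2_eq_2)
next
  case (step k)
  have "{1..<2 * Suc k} = insert (2 * k + 1) (insert (2 * k) {1..<2 * k})"
    using step.hyps by auto
  then show ?case using step.IH by simp
qed

text \<open>
  With centre \<open>c\<close>, the spoke to path vertex \<open>w\<close> has sum \<open>2 c + zigzag w\<close>, congruent to \<open>1 + zigzag w\<close>. The
  values \<open>1 + zigzag w\<close> for \<open>0 \<le> w \<le> 2 k\<close> are a complete residue system, and \<open>w = 0\<close> is the one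
  that no spoke uses.
\<close>

lemma sum_spoke_signs:
  fixes h :: "int \<Rightarrow> int"
  assumes "\<And>x y. [x = y] (mod int (2 * k + 1)) \<Longrightarrow> h x = h y"
  shows "(\<Sum>w\<in>{1..2 * k}. h (1 + zigzag w)) = (\<Sum>x\<in>{0..<int (2 * k + 1)}. h x) - h 1"
proof -
  have "(\<Sum>w\<in>{0..2 * k}. h (1 + zigzag w)) = (\<Sum>y\<in>{- int k..int k}. h (1 + y))"
    by (rule sum.reindex_bij_betw[OF bij_betw_zigzag, of "\<lambda>y. h (1 + y)"])
  also have "\<dots> = (\<Sum>x\<in>{1 - int k..<1 - int k + int (2 * k + 1)}. h x)"
    by (rule sum.reindex_bij_witness[where i = "\<lambda>x. x - 1" and j = "\<lambda>y. 1 + y"]) auto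
  also have "\<dots> = (\<Sum>x\<in>{0..<int (2 * k + 1)}. h x)"
    using assms by (intro sum_periodic) auto
  finally have "(\<Sum>w\<in>{0..2 * k}. h (1 + zigzag w)) = (\<Sum>x\<in>{0..<int (2 * k + 1)}. h x)" .
  moreover have "{0..2 * k} = insert 0 {1..2 * k}" by auto
  ultimately show ?thesis by simp
qed

section \<open>Cordiality of the corona\<close>

text \<open>
  Since the endpoints of an edge \<open>e = {a, b}\<close> are distinct, \<open>f a + f b\<close> is the sum of \<open>f\<close> over the
  set \<open>e\<close>. This makes the induced label an explicit function of the unordered edge.
\<close>

lemma induced_edge_labeling_plus:
  assumes "simple_graph G"
  shows "induced_edge_labeling \<eta> \<zeta> (+) G f (\<lambda>e. arithmetic_label \<eta> \<zeta> (+) (sum f e) 0)"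
proof -
  have "a \<noteq> b" if "{a, b} \<in> edges G" for a b
    using that assms by (auto simp: simple_graph_def)
  then show ?thesis by (auto simp: induced_edge_labeling_def arithmetic_label_def)
qed

theorem theorem4p3:
  fixes p n :: nat and \<zeta> :: "int \<Rightarrow> nat" and \<epsilon> :: int and G :: "'a ugraph"
  assumes "prime p" and "odd p" and "p \<ge> 3" and "n \<ge> 2"
    and "\<And>\<xi>. gcd \<xi> (int p) = 1 \<Longrightarrow> \<zeta> \<xi> \<in> {0, 1}"
    and "\<And>\<theta>1 \<theta>2. gcd \<theta>1 (int p) = 1 \<Longrightarrow> gcd \<theta>2 (int p) = 1 \<Longrightarrow>
           [\<theta>1 = \<theta>2] (mod int p) \<Longrightarrow> \<zeta> \<theta>1 = \<zeta> \<theta>2"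
    and "card {a. \<zeta> a = 0 \<and> 1 \<le> a \<and> a \<le> int p - 1} = (p - 1) div 2"
    and "card {a. \<zeta> a = 1 \<and> 1 \<le> a \<and> a \<le> int p - 1} = (p - 1) div 2"
    and "\<zeta> 1 = 1" and "\<zeta> 2 = 0"
    and "simple_graph G" and "connected_graph G"
    and "graph_order G = n"
    and "int (graph_size G) = int n + \<epsilon>" and "\<epsilon> \<in> {-1, 0, 1}"
  shows "arithmetic_cordial_graph p {1..int (n * p)} \<zeta> (+) (corona G (path_graph (p - 1)))"
proof -
  obtain k where k: "p = 2 * k + 1" using \<open>odd p\<close> by (elim oddE)
  have k1: "k \<ge> 1" using k \<open>p \<ge> 3\<close> by simp
  have finG: "finite (verts G)" using \<open>simple_graph G\<close> by (simp add: simple_graph_def)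
  obtain b where b: "bij_betw b (verts G) {0..<n}"
    using ex_bij_betw_finite_nat[OF finG] \<open>graph_order G = n\<close> by (auto simp: graph_order_def)
  define f where "f = zigzag_labeling k b"
  define C where "C = corona G (path_graph (2 * k))"
  define g where "g = (\<lambda>e. arithmetic_label p \<zeta> (+) (sum f e) 0)"
  define h where "h = label_sign p \<zeta>"
  have simpC: "simple_graph C"
    unfolding C_def by (intro simple_graph_corona simple_graph_path_graph) fact
  have hcong: "h x = h y" if "[x = y] (mod int p)" for x y
    unfolding h_def using label_sign_cong[OF assms(6) that] .
  have h1: "h 1 = - 1" using \<open>\<zeta> 1 = 1\<close> by (simp add: h_def label_sign_eq)
  have h2: "h 2 = 1" using \<open>\<zeta> 2 = 0\<close> by (simp add: h_def label_sign_eq)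
  \<comment> \<open>All centres lie at the midpoint \<open>k + 1\<close> modulo \<open>p\<close>, and \<open>2 (k + 1) = p + 1\<close>.\<close>
  have reduce: "h (int p * int i + int (k + 1) + s + (int p * int j + int (k + 1) + t)) = h (1 + s + t)"
    for i j s t
  proof (rule hcong)
    have eq: "int p * int i + int (k + 1) + s + (int p * int j + int (k + 1) + t)
        = (1 + s + t) + int p * (int i + int j + 1)"
      by (simp add: k algebra_simps)
    show "[int p * int i + int (k + 1) + s + (int p * int j + int (k + 1) + t) = 1 + s + t] (mod int p)"
      unfolding eq cong_def by (rule mod_mult_self2)
  qed
  note f_simps = zigzag_labeling_simps[of k b, folded f_def k]
  have inner: "h (sum f (Inl ` e)) = - 1" if "e \<in> edges G" for e
  proof -
    obtain a c where "e = {a, c}" "a \<noteq> c"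
      using simple_graph_edgeE[OF \<open>simple_graph G\<close> \<open>e \<in> edges G\<close>] .
    then have "sum f (Inl ` e) = f (Inl a) + f (Inl c)" by simp
    then show ?thesis using reduce[of "b a" 0 "b c" 0] h1 by (simp add: f_simps)
  qed
  have path: "h (sum f ((\<lambda>w. Inr (v, w)) ` {i, i + 1})) = (if odd i then - 1 else 1)" for v i
  proof -
    have "sum f ((\<lambda>w. Inr (v, w)) ` {i, i + 1}) = f (Inr (v, i)) + f (Inr (v, i + 1))" by simp
    then have "h (sum f ((\<lambda>w. Inr (v, w)) ` {i, i + 1})) = h (1 + zigzag i + zigzag (i + 1))"
      by (simp only: f_simps reduce)
    also have "1 + zigzag i + zigzag (i + 1) = (if odd i then 1 else 2)"
      using zigzag_consecutive[of i] by (simp split: if_splits)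
    finally show ?thesis using h1 h2 by simp
  qed
  have spoke: "h (sum f {Inl v, Inr (v, w)}) = h (1 + zigzag w)" for v w
    using reduce[of "b v" 0 "b v" "zigzag w"] by (simp add: f_simps)
  have spokes: "(\<Sum>w\<in>{1..2 * k}. h (1 + zigzag w)) = 2"
  proof -
    have "(\<Sum>x\<in>{0..<int p}. h x) = 1"
      unfolding h_def using assms(1,5,7,8) by (intro sum_label_sign) simp_all
    moreover have "(\<Sum>w\<in>{1..2 * k}. h (1 + zigzag w)) = (\<Sum>x\<in>{0..<int p}. h x) - h 1"
      using sum_spoke_signs[of k h] hcong unfolding k by blast
    ultimately show ?thesis using h1 by simp
  qed
  have "int (edge_count C g 0) - int (edge_count C g 1) = (\<Sum>e\<in>edges C. h (sum f e))"
    using simple_graph_finite_edges[OF simpC]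
    by (subst edge_count_difference) (auto simp: g_def h_def label_sign_def arithmetic_label_def)
  also have "\<dots> = (\<Sum>e\<in>edges G. h (sum f (Inl ` e)))
      + (\<Sum>v\<in>verts G. \<Sum>e\<in>edges (path_graph (2 * k)). h (sum f ((\<lambda>w. Inr (v, w)) ` e)))
      + (\<Sum>v\<in>verts G. \<Sum>w\<in>verts (path_graph (2 * k)). h (sum f {Inl v, Inr (v, w)}))"
    unfolding C_def by (intro sum_edges_corona simple_graph_path_graph) fact
  also have "(\<Sum>e\<in>edges G. h (sum f (Inl ` e))) = - (int n + \<epsilon>)"
    using inner \<open>int (graph_size G) = int n + \<epsilon>\<close> by (simp add: graph_size_def)
  also have "(\<Sum>v\<in>verts G. \<Sum>e\<in>edges (path_graph (2 * k)). h (sum f ((\<lambda>w. Inr (v, w)) ` e))) = - int n"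
    using \<open>graph_order G = n\<close> sum_alternating_signs[OF k1]
    by (simp only: sum_edges_path_graph path graph_order_def) simp
  also have "(\<Sum>v\<in>verts G. \<Sum>w\<in>verts (path_graph (2 * k)). h (sum f {Inl v, Inr (v, w)})) = 2 * int n"
    using \<open>graph_order G = n\<close> spokes
    by (simp only: spoke graph_order_def path_graph_def ugraph.simps) simp
  finally have "\<bar>int (edge_count C g 0) - int (edge_count C g 1)\<bar> \<le> 1"
    using \<open>\<epsilon> \<in> {-1, 0, 1}\<close> by auto
  moreover have "induced_edge_labeling p \<zeta> (+) C f g"
    unfolding g_def by (rule induced_edge_labeling_plus[OF simpC])
  moreover have "bij_betw f (verts C) {1..int (n * p)}"
    using bij_betw_zigzag_labeling[OF finG b, of k] unfolding f_def C_def k .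
  ultimately have "arithmetic_cordial_labeling p {1..int (n * p)} \<zeta> (+) C f"
    unfolding arithmetic_cordial_labeling_def by blast
  moreover have "connected_graph C"
    unfolding C_def by (rule connected_graph_corona) fact
  moreover have "arithmetic_structure p {1..int (n * p)} \<zeta> (+)"
    using assms(5) k by (simp add: arithmetic_structure_def)
  ultimately have "arithmetic_cordial_graph p {1..int (n * p)} \<zeta> (+) C"
    using simpC unfolding arithmetic_cordial_graph_def by blast
  moreover have "C = corona G (path_graph (p - 1))" by (simp add: C_def k)
  ultimately show ?thesis by simp
qed

end
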